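(* Let $\phi=\phi_{\mathbb{Z}[i]}$ be the minimal Euclidean function on $\mathbb{Z}[i]$. For every integer $k\ge 1$, \[ \phi^{-1}(2k+1)=\coprod_{j=0}^{k}\left\{a+bi:\ \begin{array}{c}2^j\parallel (a+bi);\ |a|,|b|\le w_{2k+1}-2^{j+1};\ |a|+|b|\le w_{2k+2}-3\cdot 2^j;\\ \text{and either } \max(|a|,|b|)>w_{2k}-2^{j+1} \text{ or } |a|+|b|>w_{2k+1}-3\cdot 2^j\end{array}\right\} \] and \[ \phi^{-1}(2k)=\{\pm 2^k,\pm 2^k i\}\ \cup\ \coprod_{j=0}^{k-1}\left\{a+bi:\ \begin{array}{c}2^j\parallel (a+bi);\ |a|,|b|\le w_{2k}-2^{j+1};\ |a|+|b|\le w_{2k+1}-3\cdot 2^j;\\ \text{and either } \max(|a|,|b|)>w_{2k-1}-2^{j+1} \text{ or } |a|+|b|>w_{2k}-3\cdot 2^j\end{array}\right\}. \]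
   Context: For $k\ge 0$ set $w_{2k}=3\cdot 2^k$ and $w_{2k+1}=4\cdot 2^k$. For a Gaussian integer $z\neq 0$, $2^j\parallel z$ means $2^j$ divides $z$ in $\mathbb{Z}[i]$ but $2^{j+1}$ does not. For $M\subseteq\mathbb{Z}[i]$ and $\beta\in\mathbb{Z}[i]$, write $M\twoheadrightarrow \mathbb{Z}[i]/\beta$ if every residue class of $\mathbb{Z}[i]/(\beta)$ has a representative in $M$. The Motzkin sets are $A_{\mathbb{Z}[i],0}=\{0,\pm1,\pm i\}$ and, for $j\ge1$, $A_{\mathbb{Z}[i],j}=A_{\mathbb{Z}[i],j-1}\cup\{\beta: A_{\mathbb{Z}[i],j-1}\twoheadrightarrow\mathbb{Z}[i]/\beta\}$. The minimal Euclidean function $\phi_{\mathbb{Z}[i]}:\mathbb{Z}[i]\setminus 0\to\mathbb{N}$ is $\phi_{\mathbb{Z}[i]}(a)=j$ where $j$ is least with $a\in A_{\mathbb{Z}[i],j}$ (equivalently, the pointwise minimum of all Euclidean functions on $\mathbb{Z}[i]$). *)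

theory Defs
  imports Main
begin

codatatype gauss_int = Gauss (gre: int) (gim: int)

lemma gauss_int_eq_iff: "x = y \<longleftrightarrow> gre x = gre y \<and> gim x = gim y"
  by (auto intro: gauss_int.expand)

instantiation gauss_int :: comm_ring_1
begin

primcorec zero_gauss_int where
  "gre 0 = 0"
| "gim 0 = 0"

primcorec one_gauss_int where
  "gre 1 = 1"
| "gim 1 = 0"

primcorec plus_gauss_int where
  "gre (x + y) = gre x + gre y"
| "gim (x + y) = gim x + gim y"

primcorec minus_gauss_int where
  "gre (x - y) = gre x - gre y"
| "gim (x - y) = gim x - gim y"

primcorec uminus_gauss_int where
  "gre (- x) = - gre x"
| "gim (- x) = - gim x"

primcorec times_gauss_int where
  "gre (x * y) = gre x * gre y - gim x * gim y"
| "gim (x * y) = gre x * gim y + gim x * gre y"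

instance
  by standard (simp_all add: gauss_int_eq_iff algebra_simps)

end

definition imag_unit :: gauss_int where
  "imag_unit = Gauss 0 1"

definition surjects_mod :: "gauss_int set \<Rightarrow> gauss_int \<Rightarrow> bool" where
  "surjects_mod M \<beta> \<longleftrightarrow> (\<forall>x. \<exists>m\<in>M. \<beta> dvd (x - m))"

primrec motzkin :: "nat \<Rightarrow> gauss_int set" where
  "motzkin 0 = {0, 1, - 1, imag_unit, - imag_unit}"
| "motzkin (Suc j) = motzkin j \<union> {\<beta>. surjects_mod (motzkin j) \<beta>}"

text \<open>The minimal Euclidean function has domain the nonzero Gaussian integers; being a total
  function here, it also takes a value at 0, which carries no meaning. Its fibres
  are therefore taken among the nonzero elements.\<close>

definition min_euclid :: "gauss_int \<Rightarrow> nat" where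
  "min_euclid a = (LEAST j. a \<in> motzkin j)"

definition min_euclid_fibre :: "nat \<Rightarrow> gauss_int set" where
  "min_euclid_fibre n = {z. z \<noteq> 0 \<and> min_euclid z = n}"

definition pow2_exactly_divides :: "nat \<Rightarrow> gauss_int \<Rightarrow> bool" where
  "pow2_exactly_divides j z \<longleftrightarrow> 2 ^ j dvd z \<and> \<not> 2 ^ (j + 1) dvd z"

text \<open>Integer-valued, so that the differences in the bounds below are not truncated.\<close>

definition w :: "nat \<Rightarrow> int" where
  "w n = (if even n then 3 * 2 ^ (n div 2) else 4 * 2 ^ (n div 2))"

definition odd_layer :: "nat \<Rightarrow> nat \<Rightarrow> gauss_int set" where
  "odd_layer k j = {Gauss a b | a b.
     pow2_exactly_divides j (Gauss a b) \<and>
     \<bar>a\<bar> \<le> w (2 * k + 1) - 2 ^ (j + 1) \<and> \<bar>b\<bar> \<le> w (2 * k + 1) - 2 ^ (j + 1) \<and>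
     \<bar>a\<bar> + \<bar>b\<bar> \<le> w (2 * k + 2) - 3 * 2 ^ j \<and>
     (max \<bar>a\<bar> \<bar>b\<bar> > w (2 * k) - 2 ^ (j + 1) \<or> \<bar>a\<bar> + \<bar>b\<bar> > w (2 * k + 1) - 3 * 2 ^ j)}"

text \<open>Only used for \<open>k \<ge> 1\<close>, where the natural-number index \<open>2 * k - 1\<close> is exact.\<close>

definition even_layer :: "nat \<Rightarrow> nat \<Rightarrow> gauss_int set" where
  "even_layer k j = {Gauss a b | a b.
     pow2_exactly_divides j (Gauss a b) \<and>
     \<bar>a\<bar> \<le> w (2 * k) - 2 ^ (j + 1) \<and> \<bar>b\<bar> \<le> w (2 * k) - 2 ^ (j + 1) \<and>
     \<bar>a\<bar> + \<bar>b\<bar> \<le> w (2 * k + 1) - 3 * 2 ^ j \<and>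
     (max \<bar>a\<bar> \<bar>b\<bar> > w (2 * k - 1) - 2 ^ (j + 1) \<or> \<bar>a\<bar> + \<bar>b\<bar> > w (2 * k) - 3 * 2 ^ j)}"

end

(*
  Write Oct_n for the octagon |a|, |b| <= w_n - 2, |a| + |b| <= w_(n+1) - 3. The Motzkin set A_n
  consists of 0 and the dilations 2^j z with z in Oct_(n-2j) not divisible by 2; call this set D_n.
  Two facts are elementary: (1+i)y in D_(n+1) forces y in D_n, and (1+i) D_n + {0,1} lies in
  D_(n+1).

  If D_n represents all residues modulo beta, take c to be 2^m or (1+i)2^m, an associate of
  (1+i)^(n+1). Then c lies outside D_n while c - D_n lies in D_(n+1), so beta divides a nonzero
  element of D_(n+1). These sets are closed under nonzero divisors, as a cofactor 1+i shrinks the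
  octagon and an odd nonunit cofactor has norm at least 5.

  Conversely let beta = a+bi be a nonzero element of D_(n+1). A factor 1+i is removed by induction.
  If beta is odd, one may assume a > b >= 0, and every residue has a representative x in the square
  with vertices (+-1+-i)beta/2. If x is not in D_n, then it is even and close to the boundary of
  the octagon, and one of the odd points x +- beta, x +- i beta lies in Oct_n.
*)

theory Submission
  imports Defs
begin

section \<open>The sequence \<open>w\<close>\<close>

lemma w_Suc_Suc: "w (Suc (Suc n)) = 2 * w n"
  by (simp add: w_def)

lemma w_even_index: "w (2 * k) = 3 * 2 ^ k"
  by (simp add: w_def)

lemma w_odd_index: "w (Suc (2 * k)) = 4 * 2 ^ k"
  by (simp add: w_def)

lemma w_add_double: "w (n + 2 * j) = 2 ^ j * w n"
  by (induction j) (simp_all add: w_Suc_Suc)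

lemma nat_parity_cases:
  fixes n :: nat
  obtains k where "n = 2 * k" | k where "n = Suc (2 * k)"
  by (metis evenE oddE Suc_eq_plus1)

lemma even_w_Suc: "even (w (Suc n))"
  by (cases n rule: nat_parity_cases) (simp_all add: w_def)

lemma w_ge_3: "3 \<le> w n"
proof (cases n rule: nat_parity_cases)
  case (1 k)
  have "(1::int) \<le> 2 ^ k" by simp
  with 1 show ?thesis by (simp add: w_even_index)
next
  case (2 k)
  have "(1::int) \<le> 2 ^ k" by simp
  with 2 show ?thesis unfolding 2 w_odd_index by linarith
qed

lemma w_less_Suc: "w n < w (Suc n)"
  by (cases n rule: nat_parity_cases) (simp_all add: w_def)

lemma mono_w: "m \<le> n \<Longrightarrow> w m \<le> w n"
  by (rule lift_Suc_mono_le[of w]) (simp_all add: w_less_Suc less_imp_le)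

lemma w_le_two_power: "n < 2 * j \<Longrightarrow> w n \<le> 2 * 2 ^ j"
proof -
  assume "n < 2 * j"
  then obtain i where "j = Suc i" "n \<le> Suc (2 * i)" by (cases j) auto
  then show ?thesis using mono_w[of n "Suc (2 * i)"] by (simp add: w_odd_index)
qed

section \<open>Powers of two dividing a Gaussian integer\<close>

lemma two_power_gauss: "2 ^ j = Gauss (2 ^ j) 0"
proof (induction j)
  case (Suc j)
  have "(2::gauss_int) = Gauss 2 0"
    by (subst one_add_one[symmetric])
      (simp only: gauss_int_eq_iff plus_gauss_int.sel one_gauss_int.sel gauss_int.sel, simp)
  then have "2 ^ Suc j = Gauss 2 0 * Gauss (2 ^ j) 0" using Suc by simp
  then show ?case by (simp add: gauss_int_eq_iff)
qed (simp add: gauss_int_eq_iff)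

lemma Gauss_simps [simp]:
  "Gauss a b + Gauss c d = Gauss (a + c) (b + d)"
  "Gauss a b - Gauss c d = Gauss (a - c) (b - d)"
  "- Gauss a b = Gauss (- a) (- b)"
  "Gauss a b * Gauss c d = Gauss (a * c - b * d) (a * d + b * c)"
  by (simp_all add: gauss_int_eq_iff)

lemma Gauss_eq_0: "Gauss a b = 0 \<longleftrightarrow> a = 0 \<and> b = 0"
  by (simp add: gauss_int_eq_iff)

lemma one_Gauss: "1 = Gauss 1 0"
  by (simp add: gauss_int_eq_iff)

lemma two_power_dvd_Gauss: "2 ^ j dvd Gauss a b \<longleftrightarrow> 2 ^ j dvd a \<and> 2 ^ j dvd b"
proof
  assume "2 ^ j dvd Gauss a b"
  then obtain c where c: "Gauss a b = 2 ^ j * c" by (elim dvdE)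
  have "a = 2 ^ j * gre c" "b = 2 ^ j * gim c"
    using arg_cong[OF c, of gre] arg_cong[OF c, of gim] by (simp_all add: two_power_gauss)
  then show "2 ^ j dvd a \<and> 2 ^ j dvd b" by simp
next
  assume "2 ^ j dvd a \<and> 2 ^ j dvd b"
  then obtain c d where "a = 2 ^ j * c" "b = 2 ^ j * d" by (auto elim!: dvdE)
  then have "Gauss a b = 2 ^ j * Gauss c d" by (simp add: two_power_gauss)
  then show "2 ^ j dvd Gauss a b" by (rule dvdI)
qed

lemma pow2_exactly_divides_Gauss:
  "pow2_exactly_divides j (Gauss a b) \<longleftrightarrow>
    (2 ^ j dvd a \<and> 2 ^ j dvd b) \<and> \<not> (2 ^ Suc j dvd a \<and> 2 ^ Suc j dvd b)"
  unfolding pow2_exactly_divides_def two_power_dvd_Gauss by simp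

lemma pow2_exactly_divides_scaled:
  "pow2_exactly_divides j (Gauss (2 ^ j * a) (2 ^ j * b)) \<longleftrightarrow> \<not> (even a \<and> even b)"
  by (simp add: pow2_exactly_divides_Gauss mult.commute[of 2])

lemma pow2_exactly_divides_unique:
  assumes "pow2_exactly_divides i z" "pow2_exactly_divides j z"
  shows "i = j"
proof -
  have False if "i < j" "pow2_exactly_divides i z" "pow2_exactly_divides j z" for i j
    using that le_imp_power_dvd[of "i + 1" j "2::gauss_int"]
    by (auto simp: pow2_exactly_divides_def intro: dvd_trans)
  then show ?thesis using assms by (metis linorder_neqE_nat)
qed

lemma pow2_primitive_part:
  assumes "Gauss a b \<noteq> 0"
  obtains j c d where "a = 2 ^ j * c" "b = 2 ^ j * d" "\<not> (even c \<and> even d)"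
proof -
  have "\<exists>j c d. a = 2 ^ j * c \<and> b = 2 ^ j * d \<and> \<not> (even c \<and> even d)"
    using assms
  proof (induction "nat (\<bar>a\<bar> + \<bar>b\<bar>)" arbitrary: a b rule: less_induct)
    case less
    show ?case
    proof (cases "even a \<and> even b")
      case True
      then obtain a' b' where ab: "a = 2 * a'" "b = 2 * b'" by (auto elim!: evenE)
      with less.prems have "Gauss a' b' \<noteq> 0" by (auto simp: Gauss_eq_0)
      moreover from this ab have "nat (\<bar>a'\<bar> + \<bar>b'\<bar>) < nat (\<bar>a\<bar> + \<bar>b\<bar>)"
        by (auto simp: Gauss_eq_0)
      ultimately obtain j c d where "a' = 2 ^ j * c" "b' = 2 ^ j * d" "\<not> (even c \<and> even d)"
        using less.hyps by blast
      with ab have "a = 2 ^ Suc j * c" "b = 2 ^ Suc j * d" "\<not> (even c \<and> even d)" by simp_all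
      then show ?thesis by blast
    next
      case False
      then show ?thesis by (intro exI[of _ 0] exI[of _ a] exI[of _ b]) simp
    qed
  qed
  with that show ?thesis by blast
qed

section \<open>Octagons and the candidate sets\<close>

text \<open>For t = 2^j with 2j \<le> n this is 2^j times the octagon of index n - 2j, because
  \<open>w\<close> doubles when its index rises by 2. Keeping the scale as a parameter matches the
  inequalities of the theorem.\<close>

definition octagon :: "nat \<Rightarrow> int \<Rightarrow> int \<Rightarrow> int \<Rightarrow> bool" where
  "octagon n t a b \<longleftrightarrow>
     \<bar>a\<bar> \<le> w n - 2 * t \<and> \<bar>b\<bar> \<le> w n - 2 * t \<and> \<bar>a\<bar> + \<bar>b\<bar> \<le> w (Suc n) - 3 * t"

text \<open>Zero is added by hand, since no power of 2 divides it exactly.\<close>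

definition octagon_set :: "nat \<Rightarrow> gauss_int set" where
  "octagon_set n =
     insert 0 {Gauss a b | a b. \<exists>j. pow2_exactly_divides j (Gauss a b) \<and> octagon n (2 ^ j) a b}"

lemma Gauss_in_octagon_set:
  assumes "pow2_exactly_divides j (Gauss a b)"
  shows "Gauss a b \<in> octagon_set n \<longleftrightarrow> octagon n (2 ^ j) a b"
proof -
  have "Gauss a b \<noteq> 0" using assms by (auto simp: pow2_exactly_divides_def)
  then show ?thesis
    using assms pow2_exactly_divides_unique by (auto simp: octagon_set_def)
qed

text \<open>For 2j > n the bound w n - 2 * 2^j is at most 0, which leaves only the origin. This
  controls the truncated difference \<open>n - 2 * j\<close> in
  \<open>scaled_in_octagon_set\<close>.\<close>

lemma octagon_exponent_le:
  assumes "\<not> (even a \<and> even b)" "octagon n (2 ^ j) (2 ^ j * a) (2 ^ j * b)"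
  shows "2 * j \<le> n"
proof (rule ccontr)
  assume "\<not> 2 * j \<le> n"
  then have "w n \<le> 2 * 2 ^ j" by (intro w_le_two_power) simp
  with assms(2) have "\<bar>2 ^ j * a\<bar> \<le> 0" "\<bar>2 ^ j * b\<bar> \<le> 0"
    unfolding octagon_def by linarith+
  then show False using assms(1) by simp
qed

lemma octagon_scaled:
  "octagon (n + 2 * j) (2 ^ j) (2 ^ j * a) (2 ^ j * b) \<longleftrightarrow> octagon n 1 a b"
proof -
  have *: "2 ^ j * x \<le> 2 ^ j * y \<longleftrightarrow> x \<le> y" for x y :: int by simp
  have "w (Suc (n + 2 * j)) = 2 ^ j * w (Suc n)" using w_add_double[of "Suc n" j] by simp
  then show ?thesis
    using *[of "\<bar>a\<bar>" "w n - 2"] *[of "\<bar>b\<bar>" "w n - 2"] *[of "\<bar>a\<bar> + \<bar>b\<bar>" "w (Suc n) - 3"]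
    w_add_double[of n j]
    by (simp add: octagon_def abs_mult algebra_simps)
qed

lemma scaled_in_octagon_set:
  assumes "\<not> (even a \<and> even b)"
  shows "Gauss (2 ^ j * a) (2 ^ j * b) \<in> octagon_set n \<longleftrightarrow> 2 * j \<le> n \<and> octagon (n - 2 * j) 1 a b"
proof -
  have "Gauss (2 ^ j * a) (2 ^ j * b) \<in> octagon_set n \<longleftrightarrow> octagon n (2 ^ j) (2 ^ j * a) (2 ^ j * b)"
    using assms by (intro Gauss_in_octagon_set) (simp add: pow2_exactly_divides_scaled)
  then show ?thesis
    using octagon_scaled[of "n - 2 * j" j a b] octagon_exponent_le[OF assms, of n j] by auto
qed

lemma primitive_in_octagon_set:
  "\<not> (even a \<and> even b) \<Longrightarrow> Gauss a b \<in> octagon_set n \<longleftrightarrow> octagon n 1 a b"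
  using scaled_in_octagon_set[of a b 0 n] by simp

lemma zero_in_octagon_set [simp]: "0 \<in> octagon_set n"
  by (simp add: octagon_set_def)

lemma octagon_set_cases:
  assumes "z \<in> octagon_set n"
  obtains "z = 0"
  | j c d where "z = Gauss (2 ^ j * c) (2 ^ j * d)" "\<not> (even c \<and> even d)" "2 * j \<le> n"
      "octagon (n - 2 * j) 1 c d"
proof (cases "z = 0")
  case False
  obtain j c d where "gre z = 2 ^ j * c" "gim z = 2 ^ j * d" and 2: "\<not> (even c \<and> even d)"
    using pow2_primitive_part[of "gre z" "gim z"] False by auto
  then have 1: "z = Gauss (2 ^ j * c) (2 ^ j * d)" by (simp add: gauss_int_eq_iff)
  then show ?thesis using that(2)[OF 1 2] assms scaled_in_octagon_set[OF 2] by auto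
qed (use that in blast)

lemma octagon_set_subset_Suc: "octagon_set n \<subseteq> octagon_set (Suc n)"
proof -
  have "octagon (Suc n) t a b" if "octagon n t a b" for t a b
    using that w_less_Suc[of n] w_less_Suc[of "Suc n"] by (auto simp: octagon_def)
  then show ?thesis by (fastforce simp: octagon_set_def)
qed

lemma octagon_set_symmetries:
  "Gauss a b \<in> octagon_set n \<longleftrightarrow> Gauss (- b) a \<in> octagon_set n"
  "Gauss a b \<in> octagon_set n \<longleftrightarrow> Gauss a (- b) \<in> octagon_set n"
  by (auto simp: octagon_set_def Gauss_eq_0 pow2_exactly_divides_Gauss octagon_def add.commute conj_commute)

lemma octagon_set_0: "octagon_set 0 = {0, 1, - 1, imag_unit, - imag_unit}"
proof -
  have *: "octagon 0 1 a b \<longleftrightarrow> \<bar>a\<bar> + \<bar>b\<bar> \<le> 1" for a b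
    by (auto simp: octagon_def w_def)
  have "z \<in> octagon_set 0 \<longleftrightarrow> \<bar>gre z\<bar> + \<bar>gim z\<bar> \<le> 1" for z
  proof
    assume "z \<in> octagon_set 0"
    then show "\<bar>gre z\<bar> + \<bar>gim z\<bar> \<le> 1"
      by (cases rule: octagon_set_cases) (auto simp: *)
  next
    assume A: "\<bar>gre z\<bar> + \<bar>gim z\<bar> \<le> 1"
    show "z \<in> octagon_set 0"
    proof (cases "z = 0")
      case False
      then have "\<not> (even (gre z) \<and> even (gim z))"
        using A by (auto simp: gauss_int_eq_iff elim!: evenE)
      then show ?thesis using A primitive_in_octagon_set[of "gre z" "gim z" 0] * by simp
    qed simp
  qed
  moreover have "z \<in> {0, 1, - 1, imag_unit, - imag_unit} \<longleftrightarrow> \<bar>gre z\<bar> + \<bar>gim z\<bar> \<le> 1" for z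
    by (auto simp: gauss_int_eq_iff imag_unit_def)
  ultimately show ?thesis by blast
qed

section \<open>Multiplication by 1+i\<close>

text \<open>Since max(|c-d|, |c+d|) = |c| + |d| and |c-d| + |c+d| = 2 max(|c|, |d|), multiplication
  by 1+i exchanges the two kinds of sides of the octagon.\<close>

lemma octagon_rotate:
  "octagon (Suc m) 1 (c - d) (c + d) \<longleftrightarrow>
    \<bar>c\<bar> + \<bar>d\<bar> \<le> w (Suc m) - 2 \<and> 2 * \<bar>c\<bar> \<le> 2 * w m - 3 \<and> 2 * \<bar>d\<bar> \<le> 2 * w m - 3"
  unfolding octagon_def w_Suc_Suc by auto

text \<open>Let c + di be the primitive part of y. If c + d is odd, the product has the same
  exponent i of 2. If c + d is even, then (1+i)(c+di) = 2(e+fi): the exponent rises by one and the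
  octagon index of the primitive part falls by one instead of rising.\<close>

lemma octagon_set_mult_1_i_cancel:
  assumes "Gauss 1 1 * y \<in> octagon_set (Suc n)"
  shows "y \<in> octagon_set n"
proof (cases "y = 0")
  case False
  obtain i c d where cd: "gre y = 2 ^ i * c" "gim y = 2 ^ i * d" "\<not> (even c \<and> even d)"
    using pow2_primitive_part[of "gre y" "gim y"] False by auto
  then have y: "y = Gauss (2 ^ i * c) (2 ^ i * d)" by (simp add: gauss_int_eq_iff)
  show ?thesis
  proof (cases "even (c + d)")
    case False
    have prod: "Gauss 1 1 * y = Gauss (2 ^ i * (c - d)) (2 ^ i * (c + d))"
      by (simp add: y algebra_simps)
    have "2 * i \<le> Suc n" and o: "octagon (Suc n - 2 * i) 1 (c - d) (c + d)"
      using assms False unfolding prod by (subst (asm) scaled_in_octagon_set; simp)+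
    show ?thesis
    proof (cases "Suc n = 2 * i")
      case True
      then have "octagon 0 1 (c - d) (c + d)" using o by simp
      then have "c = 0 \<and> d = 0" by (auto simp: octagon_def w_def)
      then show ?thesis using cd by simp
    next
      case nn: False
      define m where "m = n - 2 * i"
      have m: "Suc n - 2 * i = Suc m" "2 * i \<le> n" using nn \<open>2 * i \<le> Suc n\<close> by (auto simp: m_def)
      \<comment> \<open>Rotation yields only the bound w (Suc m) - 2 on an odd sum; as w (Suc m) is
        even, the required w (Suc m) - 3 follows.\<close>
      have "\<bar>c\<bar> + \<bar>d\<bar> \<noteq> w (Suc m) - 2"
      proof
        assume "\<bar>c\<bar> + \<bar>d\<bar> = w (Suc m) - 2"
        then have "even (\<bar>c\<bar> + \<bar>d\<bar>)" using even_w_Suc[of m] by simp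
        then show False using False by simp
      qed
      then have "octagon m 1 c d"
        using o unfolding m octagon_rotate by (auto simp: octagon_def)
      then show ?thesis unfolding y using cd m by (simp add: scaled_in_octagon_set m_def)
    qed
  next
    case True
    then obtain f where f: "c + d = 2 * f" by blast
    define e where "e = c - f"
    have ef: "c = f + e" "d = f - e" using f by (auto simp: e_def)
    have odd: "\<not> (even e \<and> even f)" using cd(3) ef by auto
    have "Gauss 1 1 * y = Gauss (2 ^ Suc i * e) (2 ^ Suc i * f)"
      by (simp add: y ef algebra_simps)
    then have n: "2 * Suc i \<le> Suc n" and o: "octagon (Suc n - 2 * Suc i) 1 e f"
      using assms odd by (simp_all add: scaled_in_octagon_set del: power_Suc)
    define m where "m = Suc n - 2 * Suc i"
    have m: "n - 2 * i = Suc m" using n by (auto simp: m_def)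
    have "octagon (Suc m) 1 c d"
      using o unfolding m_def[symmetric] ef octagon_def w_Suc_Suc by auto
    then show ?thesis unfolding y using cd n m by (simp add: scaled_in_octagon_set)
  qed
qed simp

lemma octagon_set_mult_1_i:
  assumes "z \<in> octagon_set n"
  shows "Gauss 1 1 * z \<in> octagon_set (Suc n)"
  using assms
proof (cases rule: octagon_set_cases)
  case (2 i c d)
  show ?thesis
  proof (cases "even (c + d)")
    case False
    have prod: "Gauss 1 1 * z = Gauss (2 ^ i * (c - d)) (2 ^ i * (c + d))"
      by (simp add: 2 algebra_simps)
    have "octagon (Suc (n - 2 * i)) 1 (c - d) (c + d)"
      using 2(4) unfolding octagon_rotate by (auto simp: octagon_def)
    then show ?thesis unfolding prod using 2(3) False
      by (subst scaled_in_octagon_set) (auto simp: Suc_diff_le)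
  next
    case True
    then obtain f where f: "c + d = 2 * f" by blast
    define e where "e = c - f"
    have ef: "c = f + e" "d = f - e" using f by (auto simp: e_def)
    have odd: "\<not> (even e \<and> even f)" and cd: "odd c" "odd d" using 2(2) ef by auto
    have prod: "Gauss 1 1 * z = Gauss (2 ^ Suc i * e) (2 ^ Suc i * f)"
      by (simp add: 2 ef algebra_simps)
    \<comment> \<open>The octagon of index 0 contains only the units and 0, each with a zero
      coordinate, whereas c and d are both odd.\<close>
    have "n \<noteq> 2 * i"
    proof
      assume "n = 2 * i"
      then have "octagon 0 1 c d" using 2 by simp
      then have "c = 0 \<or> d = 0" by (auto simp: octagon_def w_def)
      then show False using cd by auto
    qed
    then obtain m where m: "n - 2 * i = Suc m" using 2(3) by (metis Suc_diff_Suc le_neq_implies_less)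
    have "octagon (Suc m) 1 c d" using 2(4) m by simp
    moreover have "even (w (Suc m) - 2)" using even_w_Suc[of m] by simp
    then have "\<bar>c\<bar> \<noteq> w (Suc m) - 2" "\<bar>d\<bar> \<noteq> w (Suc m) - 2"
      using cd by (metis dvd_abs_iff)+
    ultimately have "octagon m 1 e f"
      unfolding ef octagon_def w_Suc_Suc by auto
    moreover have "Suc n - 2 * Suc i = m" "2 * Suc i \<le> Suc n" using m by auto
    ultimately show ?thesis unfolding prod scaled_in_octagon_set[OF odd] by simp
  qed
qed simp

text \<open>Apart from z = 0, the bounds for (1+i)z are at most w (n+1) - 3t and 2 w n - 4t, so
  adding 1 fits exactly at t = 1. The new point has odd coordinate sum, so only the octagon at scale
  1 has to be checked, whatever power of 2 divides z.\<close>

lemma octagon_set_mult_1_i_add_1: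
  assumes "z \<in> octagon_set n"
  shows "Gauss 1 1 * z + 1 \<in> octagon_set (Suc n)"
  using assms
proof (cases rule: octagon_set_cases)
  case 1
  have "octagon (Suc n) 1 1 0"
    using w_ge_3[of n] w_less_Suc[of n] w_less_Suc[of "Suc n"] by (simp add: octagon_def)
  with 1 show ?thesis by (simp add: one_Gauss primitive_in_octagon_set)
next
  case (2 i c d)
  define t :: int where "t = 2 ^ i"
  have t: "1 \<le> t" by (simp add: t_def)
  have "octagon n t (t * c) (t * d)"
    using octagon_scaled[of "n - 2 * i" i c d] 2 by (simp add: t_def)
  then have "octagon (Suc n) 1 (t * c - t * d + 1) (t * c + t * d)"
    using t unfolding octagon_def w_Suc_Suc by auto
  moreover have "Gauss 1 1 * z + 1 = Gauss (t * c - t * d + 1) (t * c + t * d)"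
    by (simp add: 2 one_Gauss t_def)
  moreover have "\<not> (even (t * c - t * d + 1) \<and> even (t * c + t * d))" by auto
  ultimately show ?thesis using primitive_in_octagon_set by metis
qed

section \<open>Closure under nonzero divisors\<close>

text \<open>An odd cofactor preserves the exponent of 2, so primitive parts can be compared. A unit
  only permutes coordinates up to sign. Otherwise the cofactor has norm at least 4, so 2(c^2 + d^2)
  \<le> U^2 and hence |c| + |d| \<le> U, well inside the octagon.\<close>

lemma octagon_set_odd_factor:
  assumes "x * y \<in> octagon_set n" "odd (gre y + gim y)"
  shows "x \<in> octagon_set n"
proof (cases "x = 0")
  case False
  obtain i c d where cd: "gre x = 2 ^ i * c" "gim x = 2 ^ i * d" "\<not> (even c \<and> even d)"
    using pow2_primitive_part[of "gre x" "gim x"] False by auto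
  then have x: "x = Gauss (2 ^ i * c) (2 ^ i * d)" by (simp add: gauss_int_eq_iff)
  obtain p q where y: "y = Gauss p q" by (cases y)
  define e f where "e = c * p - d * q" and "f = c * q + d * p"
  have pq: "odd (p + q)" using assms(2) y by simp
  have ef: "\<not> (even e \<and> even f)" using cd(3) pq by (auto simp: e_def f_def)
  have "x * y = Gauss (2 ^ i * e) (2 ^ i * f)"
    by (simp add: x y e_def f_def algebra_simps)
  then have i: "2 * i \<le> n" and o: "octagon (n - 2 * i) 1 e f"
    using assms(1) scaled_in_octagon_set[OF ef] by auto
  define m where "m = n - 2 * i"
  have "octagon m 1 c d"
  proof (cases "\<bar>p\<bar> + \<bar>q\<bar> = 1")
    case True
    then have "p = 0 \<and> \<bar>q\<bar> = 1 \<or> q = 0 \<and> \<bar>p\<bar> = 1" by auto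
    then have "\<bar>e\<bar> = \<bar>c\<bar> \<and> \<bar>f\<bar> = \<bar>d\<bar> \<or> \<bar>e\<bar> = \<bar>d\<bar> \<and> \<bar>f\<bar> = \<bar>c\<bar>"
      by (auto simp: e_def f_def abs_mult)
    then show ?thesis using o unfolding m_def octagon_def by auto
  next
    case False
    define U where "U = w m - 2"
    have U: "1 \<le> U" using w_ge_3[of m] by (simp add: U_def)
    have "odd (\<bar>p\<bar> + \<bar>q\<bar>)" using pq by simp
    then have "3 \<le> \<bar>p\<bar> + \<bar>q\<bar>" using False by presburger
    then have "3 ^ 2 \<le> (\<bar>p\<bar> + \<bar>q\<bar>) ^ 2" by (intro power_mono) auto
    also have "\<dots> + (\<bar>p\<bar> - \<bar>q\<bar>) ^ 2 = 2 * (p ^ 2 + q ^ 2)"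
      by (simp add: power2_eq_square algebra_simps)
    then have "(\<bar>p\<bar> + \<bar>q\<bar>) ^ 2 \<le> 2 * (p ^ 2 + q ^ 2)" using zero_le_power2[of "\<bar>p\<bar> - \<bar>q\<bar>"] by linarith
    finally have N: "4 \<le> p ^ 2 + q ^ 2" by simp
    have "\<bar>e\<bar> \<le> U" "\<bar>f\<bar> \<le> U" using o by (auto simp: octagon_def m_def U_def)
    then have "e ^ 2 \<le> U ^ 2" "f ^ 2 \<le> U ^ 2" using U by (auto intro!: power2_le_iff_abs_le[THEN iffD2])
    moreover have "e ^ 2 + f ^ 2 = (c ^ 2 + d ^ 2) * (p ^ 2 + q ^ 2)"
      by (simp add: e_def f_def power2_eq_square algebra_simps)
    moreover have "(c ^ 2 + d ^ 2) * 4 \<le> (c ^ 2 + d ^ 2) * (p ^ 2 + q ^ 2)"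
      using N by (intro mult_left_mono) auto
    ultimately have "2 * (c ^ 2 + d ^ 2) \<le> U ^ 2" by linarith
    moreover have "(\<bar>c\<bar> + \<bar>d\<bar>) ^ 2 + (\<bar>c\<bar> - \<bar>d\<bar>) ^ 2 = 2 * (c ^ 2 + d ^ 2)"
      by (simp add: power2_eq_square algebra_simps)
    then have "(\<bar>c\<bar> + \<bar>d\<bar>) ^ 2 \<le> 2 * (c ^ 2 + d ^ 2)" using zero_le_power2[of "\<bar>c\<bar> - \<bar>d\<bar>"] by linarith
    ultimately have "(\<bar>c\<bar> + \<bar>d\<bar>) ^ 2 \<le> U ^ 2" by linarith
    then have "\<bar>c\<bar> + \<bar>d\<bar> \<le> U" using U power2_le_imp_le[of "\<bar>c\<bar> + \<bar>d\<bar>" U] by simp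
    then show ?thesis using w_less_Suc[of m] by (auto simp: octagon_def U_def)
  qed
  then show ?thesis unfolding x using scaled_in_octagon_set[OF cd(3)] i by (simp add: m_def)
qed simp

lemma even_sum_factor_1_i:
  assumes "even (gre y + gim y)"
  obtains y' where "y = Gauss 1 1 * y'"
proof -
  obtain f where f: "gre y + gim y = 2 * f" using assms by blast
  then have "gim y = f + (f - gre y)" by simp
  then have "y = Gauss 1 1 * Gauss f (f - gre y)" unfolding gauss_int_eq_iff Gauss_simps by simp
  then show ?thesis by (rule that)
qed

lemma octagon_set_factor:
  assumes "x * y \<in> octagon_set n" "x * y \<noteq> 0"
  shows "x \<in> octagon_set n"
  using assms
proof (induction "nat (gre y ^ 2 + gim y ^ 2)" arbitrary: y rule: less_induct)
  case less
  show ?case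
  proof (cases "even (gre y + gim y)")
    case False
    then show ?thesis using octagon_set_odd_factor less.prems by blast
  next
    case True
    then obtain y' where y: "y = Gauss 1 1 * y'" by (rule even_sum_factor_1_i)
    have xy: "x * y = Gauss 1 1 * (x * y')" unfolding y by (rule mult.left_commute)
    \<comment> \<open>Enlarging the index first compensates for the drop caused by cancelling 1+i,
      so n stays fixed during the induction on the norm of y.\<close>
    have "Gauss 1 1 * (x * y') \<in> octagon_set (Suc n)"
      using less.prems(1) octagon_set_subset_Suc unfolding xy by blast
    then have "x * y' \<in> octagon_set n" by (rule octagon_set_mult_1_i_cancel)
    moreover have "y' \<noteq> 0" "x * y' \<noteq> 0" using less.prems(2) unfolding xy by auto
    moreover have "0 < gre y' ^ 2 + gim y' ^ 2"
      using \<open>y' \<noteq> 0\<close> by (auto simp: gauss_int_eq_iff sum_power2_gt_zero_iff)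
    moreover have "gre y ^ 2 + gim y ^ 2 = 2 * (gre y' ^ 2 + gim y' ^ 2)"
      by (simp add: y power2_eq_square algebra_simps)
    ultimately show ?thesis using less.hyps[of y'] by simp
  qed
qed

section \<open>Necessity: a point outside the set whose differences lie in the next set\<close>

text \<open>Case n = 2k with s = 2^k: then w takes the values 3s, 4s, 6s at n, n+1, n+2, and the
  triangle inequality suffices for translation by (1+i)s.\<close>

lemma shift_diagonal_bounds:
  fixes X Y s t :: int
  assumes "\<bar>X\<bar> \<le> 3 * s - 2 * t \<and> \<bar>Y\<bar> \<le> 3 * s - 2 * t \<and> \<bar>X\<bar> + \<bar>Y\<bar> \<le> 4 * s - 3 * t" "0 \<le> s"
  shows "\<bar>s - X\<bar> \<le> 4 * s - 2 * t \<and> \<bar>s - Y\<bar> \<le> 4 * s - 2 * t \<and>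
    \<bar>s - X\<bar> + \<bar>s - Y\<bar> \<le> 2 * (3 * s) - 3 * t"
  using assms by auto

text \<open>Case n = 2k+1 with s = 2^k: the values of w are 4s, 6s, 8s, and the translation is by
  2s.\<close>

lemma shift_coordinate_bounds:
  fixes X Y s t :: int
  assumes "\<bar>X\<bar> \<le> 4 * s - 2 * t \<and> \<bar>Y\<bar> \<le> 4 * s - 2 * t \<and> \<bar>X\<bar> + \<bar>Y\<bar> \<le> 2 * (3 * s) - 3 * t"
    "0 \<le> s"
  shows "\<bar>2 * s - X\<bar> \<le> 2 * (3 * s) - 2 * t \<and> \<bar>0 - Y\<bar> \<le> 2 * (3 * s) - 2 * t \<and>
    \<bar>2 * s - X\<bar> + \<bar>0 - Y\<bar> \<le> 2 * (4 * s) - 3 * t"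
  using assms by auto

text \<open>The point c is divisible by such a high power of 1+i that c - b has the same exponent of
  2 as every nonzero b in the set. The scale t is therefore unchanged, and only the shift bounds
  above remain.\<close>

lemma exists_translation_octagon_set:
  "\<exists>c. c \<notin> octagon_set n \<and> (\<forall>b\<in>octagon_set n. c - b \<in> octagon_set (Suc n))"
proof (cases n rule: nat_parity_cases)
  case (1 k)
  let ?c = "Gauss (2 ^ k) (2 ^ k)"
  have "?c \<notin> octagon_set n"
    using scaled_in_octagon_set[of 1 1 k n] 1 by (simp add: octagon_def w_def)
  moreover have "?c - b \<in> octagon_set (Suc n)" if "b \<in> octagon_set n" for b
    using that
  proof (cases rule: octagon_set_cases)
    case zero: 1
    show ?thesis using scaled_in_octagon_set[of 1 1 k "Suc n"] 1 zero
      by (simp add: octagon_def w_def)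
  next
    case (2 j x y)
    define l where "l = k - j"
    have k: "k = l + j" using 1 2(3) by (simp add: l_def)
    have "octagon n (2 ^ j) (2 ^ j * x) (2 ^ j * y)"
      using octagon_scaled[of "n - 2 * j" j x y] 2 by simp
    then have o: "octagon (Suc n) (2 ^ j) (2 ^ k - 2 ^ j * x) (2 ^ k - 2 ^ j * y)"
      unfolding octagon_def 1 w_odd_index w_even_index w_Suc_Suc
      by (rule shift_diagonal_bounds) simp
    have e: "2 ^ k - 2 ^ j * x = 2 ^ j * (2 ^ l - x)" for x :: int
      by (simp add: k power_add algebra_simps)
    \<comment> \<open>For l > 0 parities do not change. For l = 0 both flip, but then x + yi is a
      unit, and its zero coordinate becomes odd.\<close>
    have "\<not> (even (2 ^ l - x) \<and> even (2 ^ l - y))"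
    proof (cases "l = 0")
      case True
      then have "octagon 0 1 x y" using 2 1 k by simp
      then have "x = 0 \<or> y = 0" by (auto simp: octagon_def w_def)
      then show ?thesis using True by auto
    qed (use 2(2) in auto)
    then have "pow2_exactly_divides j (Gauss (2 ^ k - 2 ^ j * x) (2 ^ k - 2 ^ j * y))"
      unfolding e pow2_exactly_divides_scaled .
    then show ?thesis using o by (simp add: 2(1) Gauss_in_octagon_set)
  qed
  ultimately show ?thesis by blast
next
  case (2 k)
  let ?c = "Gauss (2 ^ Suc k) 0"
  have "?c \<notin> octagon_set n"
    using scaled_in_octagon_set[of 1 0 "Suc k" n] 2 by simp
  moreover have "?c - b \<in> octagon_set (Suc n)" if "b \<in> octagon_set n" for b
    using that
  proof (cases rule: octagon_set_cases)
    case zero: 1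
    show ?thesis using scaled_in_octagon_set[of 1 0 "Suc k" "Suc n"] 2 zero
      by (simp add: octagon_def w_def)
  next
    case b: (2 j x y)
    define l where "l = k - j"
    have "j \<le> k" using 2 b(3) by linarith
    then have k: "k = l + j" by (simp add: l_def)
    have "octagon n (2 ^ j) (2 ^ j * x) (2 ^ j * y)"
      using octagon_scaled[of "n - 2 * j" j x y] b by simp
    then have o: "octagon (Suc n) (2 ^ j) (2 ^ Suc k - 2 ^ j * x) (0 - 2 ^ j * y)"
      unfolding octagon_def 2 w_Suc_Suc w_odd_index w_even_index power_Suc
      by (rule shift_coordinate_bounds) simp
    have e: "2 ^ Suc k - 2 ^ j * x = 2 ^ j * (2 ^ Suc l - x)" "0 - 2 ^ j * y = 2 ^ j * (- y)"
      by (simp_all add: k power_add algebra_simps)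
    have "pow2_exactly_divides j (Gauss (2 ^ Suc k - 2 ^ j * x) (0 - 2 ^ j * y))"
      unfolding e pow2_exactly_divides_scaled using b(2) by simp
    then show ?thesis using o by (simp add: b(1) Gauss_in_octagon_set)
  qed
  ultimately show ?thesis by blast
qed

lemma surjects_mod_octagon_set_imp:
  assumes "surjects_mod (octagon_set n) \<beta>"
  shows "\<beta> \<in> octagon_set (Suc n)"
proof -
  obtain c where c: "c \<notin> octagon_set n" "\<And>b. b \<in> octagon_set n \<Longrightarrow> c - b \<in> octagon_set (Suc n)"
    using exists_translation_octagon_set by blast
  obtain m where m: "m \<in> octagon_set n" "\<beta> dvd c - m" using assms by (auto simp: surjects_mod_def)
  then obtain y where y: "c - m = \<beta> * y" by (elim dvdE)
  have "\<beta> * y \<noteq> 0" using c m y by auto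
  then show ?thesis using octagon_set_factor[of \<beta> y] c(2)[OF m(1)] y by simp
qed

section \<open>Sufficiency for multiples of 1+i\<close>

text \<open>Write x = (1+i)q + e with e = 0 or 1. A representative m of q modulo y one level down
  gives the representative (1+i)m + e of x.\<close>

lemma surjects_mod_octagon_set_1_i_mult:
  assumes "y \<in> octagon_set n" "y \<noteq> 0"
    and IH: "\<And>m. n = Suc m \<Longrightarrow> surjects_mod (octagon_set m) y"
  shows "surjects_mod (octagon_set n) (Gauss 1 1 * y)"
  unfolding surjects_mod_def
proof
  fix x
  define e where "e = (if even (gre x + gim x) then 0 else 1 :: gauss_int)"
  have "even (gre (x - e) + gim (x - e))" by (simp add: e_def)
  then obtain q where q: "x - e = Gauss 1 1 * q" by (rule even_sum_factor_1_i)
  have "\<exists>m. y dvd q - m \<and> Gauss 1 1 * m + e \<in> octagon_set n"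
  \<comment> \<open>At level 0 there is no level below, but y is a unit there, so m = 0
    works.\<close>
  proof (cases n)
    case 0
    then have "y \<in> {1, - 1, imag_unit, - imag_unit}" using assms(1,2) octagon_set_0 by simp
    moreover have "1 = imag_unit * - imag_unit" by (simp add: imag_unit_def one_Gauss)
    then have "imag_unit dvd 1" by (rule dvdI)
    ultimately have "y dvd 1" by auto
    then have "y dvd q - 0" by (rule dvd_trans) (rule one_dvd)
    moreover have "Gauss 1 1 * 0 + e \<in> octagon_set n" by (simp add: 0 octagon_set_0 e_def)
    ultimately show ?thesis by blast
  next
    case (Suc k)
    then obtain m where m: "m \<in> octagon_set k" "y dvd q - m" using IH by (auto simp: surjects_mod_def)
    have "Gauss 1 1 * m + e \<in> octagon_set n"
      using octagon_set_mult_1_i[OF m(1)] octagon_set_mult_1_i_add_1[OF m(1)] by (simp add: e_def Suc)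
    with m show ?thesis by blast
  qed
  then obtain m where m: "y dvd q - m" "Gauss 1 1 * m + e \<in> octagon_set n" by blast
  have "x - (Gauss 1 1 * m + e) = Gauss 1 1 * (q - m)"
    using q by (simp add: algebra_simps)
  then have "Gauss 1 1 * y dvd x - (Gauss 1 1 * m + e)"
    using mult_dvd_mono[OF dvd_refl m(1)] by metis
  with m(2) show "\<exists>m\<in>octagon_set n. Gauss 1 1 * y dvd x - m" by blast
qed

section \<open>Moving an excluded point back by an associate of \<beta>\<close>

lemma nonneg_if_dvd_gt: "t dvd z \<Longrightarrow> - t < z \<Longrightarrow> 0 \<le> (z::int)"
  by (rule ccontr) (use zdvd_imp_le[of t "- z"] in auto)

text \<open>In the next two lemmas \<open>W\<close>, \<open>V\<close> stand for \<open>w n\<close>, \<open>w (Suc n)\<close>, and the point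
  \<open>X + Yi\<close>, divisible by \<open>t = 2\<^sup>j\<close>, violates one of the bounds for \<open>2\<^sup>j\<close> times the octagon.
  With \<open>\<beta> = a + bi\<close>, the two alternatives are the shifts by \<open>- \<beta>\<close> and by \<open>i\<beta>\<close> or \<open>- i\<beta>\<close>. Parity and
  divisibility by \<open>t\<close> gain the slack by which the real inequalities fail.\<close>

lemma odd_shift_coordinate:
  fixes a b X Y W V t :: int
  assumes ab: "0 \<le> b" "b < a" "odd (a + b)" "a \<le> V - 2" "a + b \<le> 2 * W - 3"
    and XY: "2 * \<bar>X\<bar> \<le> a + b" "2 * \<bar>Y\<bar> \<le> a + b" "\<bar>X\<bar> + \<bar>Y\<bar> \<le> a" "even (X + Y)"
    and dvd: "t dvd X" "t dvd Y" "t dvd W" "t dvd V" "even V"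
    and t: "0 < t" "t \<le> V - W" "t \<le> 2 * W - V"
    and X: "X > W - 2 * t" "\<bar>Y\<bar> \<le> X"
  shows "\<bar>X - a\<bar> \<le> W - 2 \<and> \<bar>Y - b\<bar> \<le> W - 2 \<and> \<bar>X - a\<bar> + \<bar>Y - b\<bar> \<le> V - 3 \<or>
    \<bar>X - b\<bar> \<le> W - 2 \<and> \<bar>Y + a\<bar> \<le> W - 2 \<and> \<bar>X - b\<bar> + \<bar>Y + a\<bar> \<le> V - 3"
proof -
  have X': "W - t \<le> X" using nonneg_if_dvd_gt[of t "X - W + t"] X dvd by auto
  have Y': "Y < W - V + t \<Longrightarrow> Y \<le> W - V"
    using nonneg_if_dvd_gt[of t "W - V - Y"] dvd by auto
  have "odd (\<bar>X - a\<bar> + \<bar>Y - b\<bar>)" "odd (\<bar>X - b\<bar> + \<bar>Y + a\<bar>)"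
    unfolding even_add dvd_abs_iff using ab(3) XY(4) by auto
  then have p: "\<bar>X - a\<bar> + \<bar>Y - b\<bar> \<noteq> V - 2" "\<bar>X - b\<bar> + \<bar>Y + a\<bar> \<noteq> V - 2"
    using dvd(5) by (metis dvd_diff dvd_refl)+
  \<comment> \<open>For Y \<ge> 0 the first alternative holds. For Y < 0, if a + Y > W - 2 then
    \<open>Y'\<close> gives - Y \<le> V - W - t, and the first holds again. If a + Y \<le> W - 2 and
    the first fails, the second holds: for X \<ge> b the two coordinate sums add up to 2a \<le> 2V -
    4, and parity supplies the last unit.\<close>
  show ?thesis
    using ab(1,2,4,5) XY(1,2,3) t X X' Y' p by (smt (verit))
qed

lemma odd_shift_diagonal:
  fixes a b X Y W V t :: int
  assumes ab: "0 \<le> b" "b < a" "odd (a + b)" "a \<le> V - 2" "a + b \<le> 2 * W - 3"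
    and XY: "2 * \<bar>X\<bar> \<le> a + b" "2 * \<bar>Y\<bar> \<le> a + b" "\<bar>X\<bar> + \<bar>Y\<bar> \<le> a" "even (X + Y)"
    and dvd: "t dvd X" "t dvd Y" "t dvd W" "t dvd V" "even V"
    and t: "0 < t" "t \<le> V - W" "t \<le> 2 * W - V"
    and X: "0 \<le> X" "0 \<le> Y" "X \<le> W - 2 * t" "Y \<le> W - 2 * t" "X + Y > V - 3 * t"
  shows "\<bar>X - a\<bar> \<le> W - 2 \<and> \<bar>Y - b\<bar> \<le> W - 2 \<and> \<bar>X - a\<bar> + \<bar>Y - b\<bar> \<le> V - 3 \<or>
    \<bar>X + b\<bar> \<le> W - 2 \<and> \<bar>Y - a\<bar> \<le> W - 2 \<and> \<bar>X + b\<bar> + \<bar>Y - a\<bar> \<le> V - 3"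
proof -
  have X': "V - 2 * t \<le> X + Y" using nonneg_if_dvd_gt[of t "X + Y - V + 2 * t"] X dvd by auto
  have Y': "X < V - W \<Longrightarrow> X \<le> V - W - t"
    using nonneg_if_dvd_gt[of t "V - W - t - X"] dvd by auto
  have "odd (\<bar>X - a\<bar> + \<bar>Y - b\<bar>)" "odd (\<bar>X + b\<bar> + \<bar>Y - a\<bar>)"
    unfolding even_add dvd_abs_iff using ab(3) XY(4) by auto
  then have p: "\<bar>X - a\<bar> + \<bar>Y - b\<bar> \<noteq> V - 2" "\<bar>X + b\<bar> + \<bar>Y - a\<bar> \<noteq> V - 2"
    using dvd(5) by (metis dvd_diff dvd_refl)+
  \<comment> \<open>By \<open>X'\<close> both X and Y are at least V - W. For Y < b the first
    alternative holds. For Y \<ge> b the two coordinate sums add up to 2a \<le> 2V - 4, so with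
    parity the second holds whenever the first fails.\<close>
  show ?thesis
    using ab(1,2,4,5) XY(1,2,3) t X X' Y' p by (smt (verit))
qed

section \<open>Reduction to the square modulo \<beta>\<close>

lemma nearest_multiple:
  fixes A N :: int
  assumes "0 < N"
  shows "\<exists>p. 2 * \<bar>A - p * N\<bar> \<le> N"
proof -
  define p where "p = (2 * A + N) div (2 * N)"
  define r where "r = (2 * A + N) mod (2 * N)"
  have "2 * A + N = p * (2 * N) + r" by (simp only: p_def r_def div_mult_mod_eq)
  moreover have "0 \<le> r" "r < 2 * N" using assms by (simp_all add: r_def)
  ultimately have "2 * \<bar>A - p * N\<bar> \<le> N" by (simp add: algebra_simps abs_if)
  then show ?thesis by blast
qed

lemma abs_bound_of_combination:
  fixes A B N Z c u v :: int
  assumes "0 < N" "2 * \<bar>A\<bar> \<le> N" "2 * \<bar>B\<bar> \<le> N" "N * Z = u * A + v * B" "\<bar>u\<bar> + \<bar>v\<bar> \<le> c"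
  shows "2 * \<bar>Z\<bar> \<le> c"
proof -
  have "N * (2 * \<bar>Z\<bar>) = 2 * \<bar>N * Z\<bar>" using assms(1) by (simp add: abs_mult)
  also have "\<dots> \<le> 2 * (\<bar>u * A\<bar> + \<bar>v * B\<bar>)" unfolding assms(4) by (intro mult_left_mono abs_triangle_ineq) simp
  also have "\<dots> = \<bar>u\<bar> * (2 * \<bar>A\<bar>) + \<bar>v\<bar> * (2 * \<bar>B\<bar>)" by (simp add: abs_mult)
  also have "\<dots> \<le> \<bar>u\<bar> * N + \<bar>v\<bar> * N"
    using assms(2,3) by (intro add_mono mult_left_mono) auto
  also have "\<dots> = N * (\<bar>u\<bar> + \<bar>v\<bar>)" by (simp add: algebra_simps)
  also have "\<dots> \<le> N * c" using assms(1,5) by (intro mult_left_mono) auto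
  finally show ?thesis using assms(1) by simp
qed

text \<open>Both coordinates of conj(\<beta>) z are rounded to multiples of the norm N, so that A +
  Bi = conj(\<beta>)(X + Yi) has coordinates at most N/2. Multiplying back by \<beta> expresses N X,
  N Y and N (X \<plusminus> Y) as combinations of A and B; the resulting bounds are the extreme
  values on the square with vertices (\<plusminus>1 \<plusminus> i)\<beta>/2.\<close>

lemma reduction_to_square:
  fixes a b :: int
  assumes "0 \<le> b" "b < a"
  obtains X Y where "Gauss a b dvd z - Gauss X Y"
    "2 * \<bar>X\<bar> \<le> a + b" "2 * \<bar>Y\<bar> \<le> a + b" "\<bar>X\<bar> + \<bar>Y\<bar> \<le> a"
proof -
  obtain x y where z: "z = Gauss x y" by (cases z)
  define N where "N = a * a + b * b"
  have N: "0 < N" using assms by (simp add: N_def add_pos_nonneg)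
  obtain p where p: "2 * \<bar>(a * x + b * y) - p * N\<bar> \<le> N" using nearest_multiple[OF N] by blast
  obtain q where q: "2 * \<bar>(a * y - b * x) - q * N\<bar> \<le> N" using nearest_multiple[OF N] by blast
  define X Y where "X = x - (a * p - b * q)" and "Y = y - (a * q + b * p)"
  define A B where "A = a * X + b * Y" and "B = a * Y - b * X"
  have A: "2 * \<bar>A\<bar> \<le> N" using p by (simp add: A_def X_def Y_def N_def algebra_simps)
  have B: "2 * \<bar>B\<bar> \<le> N" using q by (simp add: B_def X_def Y_def N_def algebra_simps)
  note bound = abs_bound_of_combination[OF N A B]
  have "z - Gauss X Y = Gauss a b * Gauss p q" by (simp add: z X_def Y_def algebra_simps)
  then have "Gauss a b dvd z - Gauss X Y" by (rule dvdI)
  moreover have "2 * \<bar>X\<bar> \<le> a + b"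
    by (rule bound[of _ a "- b"]) (use assms in \<open>simp_all add: N_def A_def B_def algebra_simps\<close>)
  moreover have "2 * \<bar>Y\<bar> \<le> a + b"
    by (rule bound[of _ b a]) (use assms in \<open>simp_all add: N_def A_def B_def algebra_simps\<close>)
  moreover have "2 * \<bar>X + Y\<bar> \<le> 2 * a"
    by (rule bound[of _ "a + b" "a - b"]) (use assms in \<open>simp_all add: N_def A_def B_def algebra_simps\<close>)
  moreover have "2 * \<bar>X - Y\<bar> \<le> 2 * a"
    by (rule bound[of _ "a - b" "- (a + b)"]) (use assms in \<open>simp_all add: N_def A_def B_def algebra_simps\<close>)
  ultimately show ?thesis using that by auto
qed

section \<open>Representing the points of the square\<close>

definition represented :: "gauss_int set \<Rightarrow> gauss_int \<Rightarrow> gauss_int \<Rightarrow> bool" where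
  "represented M \<beta> z \<longleftrightarrow> (\<exists>m\<in>M. \<beta> dvd z - m)"

lemma represented_shift:
  assumes "represented M \<beta> z'" "\<beta> dvd z - z'"
  shows "represented M \<beta> z"
proof -
  obtain m where m: "m \<in> M" "\<beta> dvd z' - m" using assms(1) by (auto simp: represented_def)
  have "z - m = (z - z') + (z' - m)" by simp
  then have "\<beta> dvd z - m" using assms(2) m(2) by (metis dvd_add)
  with m show ?thesis by (auto simp: represented_def)
qed

text \<open>Units preserve both the octagon set and the ideal of \<beta>, so the point can be
  rotated while \<beta> stays fixed.\<close>

lemma represented_rotate:
  assumes "represented (octagon_set n) \<beta> (Gauss (- Y) X)"
  shows "represented (octagon_set n) \<beta> (Gauss X Y)"
proof -
  obtain p q where m: "Gauss p q \<in> octagon_set n" "\<beta> dvd Gauss (- Y) X - Gauss p q"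
    using assms unfolding represented_def by (metis gauss_int.exhaust)
  have "Gauss X Y - Gauss q (- p) = (Gauss (- Y) X - Gauss p q) * Gauss 0 (- 1)"
    by simp
  then have "\<beta> dvd Gauss X Y - Gauss q (- p)" using m(2) by (metis dvd_mult2)
  moreover have "Gauss q (- p) \<in> octagon_set n"
    using m(1) octagon_set_symmetries by (metis minus_minus)
  ultimately show ?thesis unfolding represented_def by blast
qed

lemma represented_negate:
  assumes "represented (octagon_set n) \<beta> (Gauss (- X) (- Y))"
  shows "represented (octagon_set n) \<beta> (Gauss X Y)"
  by (rule represented_rotate, rule represented_rotate, rule assms)

lemma represented_rotate_back:
  assumes "represented (octagon_set n) \<beta> (Gauss Y (- X))"
  shows "represented (octagon_set n) \<beta> (Gauss X Y)"
proof (rule represented_negate, rule represented_rotate)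
  show "represented (octagon_set n) \<beta> (Gauss (- (- Y)) (- X))" using assms by simp
qed

lemma represented_if_octagon:
  assumes "odd (p + q)" "\<bar>p\<bar> \<le> w n - 2 \<and> \<bar>q\<bar> \<le> w n - 2 \<and> \<bar>p\<bar> + \<bar>q\<bar> \<le> w (Suc n) - 3"
    and "\<beta> dvd Gauss X Y - Gauss p q"
  shows "represented (octagon_set n) \<beta> (Gauss X Y)"
proof -
  have "Gauss p q \<in> octagon_set n"
    using assms by (subst primitive_in_octagon_set) (auto simp: octagon_def)
  then show ?thesis using assms(3) unfolding represented_def by blast
qed

lemma Gauss_dvd_associates:
  "Gauss a b dvd Gauss a b" "Gauss a b dvd Gauss b (- a)" "Gauss a b dvd Gauss (- b) a"
proof -
  have "Gauss b (- a) = Gauss a b * Gauss 0 (- 1)" "Gauss (- b) a = Gauss a b * Gauss 0 1" by simp_all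
  then show "Gauss a b dvd Gauss b (- a)" "Gauss a b dvd Gauss (- b) a" by (metis dvd_triv_left)+
qed simp

lemma represented_square_point:
  fixes a b X Y :: int
  assumes ab: "0 \<le> b" "b < a" "odd (a + b)" "octagon (Suc n) 1 a b"
    and XY: "2 * \<bar>X\<bar> \<le> a + b" "2 * \<bar>Y\<bar> \<le> a + b" "\<bar>X\<bar> + \<bar>Y\<bar> \<le> a"
  shows "represented (octagon_set n) (Gauss a b) (Gauss X Y)"
proof (cases "Gauss X Y \<in> octagon_set n")
  case True
  then show ?thesis unfolding represented_def by (intro bexI[of _ "Gauss X Y"]) simp_all
next
  case False
  have V: "even (w (Suc n))" by (rule even_w_Suc)
  have ab': "a \<le> w (Suc n) - 2" "a + b \<le> 2 * w n - 3"
    using ab unfolding octagon_def w_Suc_Suc by auto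
  obtain j c d where cd: "X = 2 ^ j * c" "Y = 2 ^ j * d" "\<not> (even c \<and> even d)"
    using pow2_primitive_part[of X Y] False zero_in_octagon_set[of n] by metis
  define t :: int where "t = 2 ^ j"
  have t: "0 < t" "t dvd X" "t dvd Y" by (simp_all add: t_def cd)
  have viol: "\<not> octagon n t X Y"
    using False Gauss_in_octagon_set[of j X Y n] cd
    by (simp add: pow2_exactly_divides_scaled t_def)
  \<comment> \<open>An odd point has scale t = 1. The bounds of the square place it in that octagon,
    parity turning w (Suc n) - 2 into w (Suc n) - 3.\<close>
  have even: "even (X + Y)"
  proof (rule ccontr)
    assume o: "odd (X + Y)"
    then have "j = 0" using cd by (cases j) auto
    moreover have "odd (\<bar>X\<bar> + \<bar>Y\<bar>)" using o by simp
    then have "\<bar>X\<bar> + \<bar>Y\<bar> \<noteq> w (Suc n) - 2" using V by (metis dvd_diff dvd_refl)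
    then have "octagon n 1 X Y" unfolding octagon_def using XY ab' by auto
    ultimately show False using viol by (simp add: t_def)
  qed
  \<comment> \<open>The shift lemmas need t to divide both values of w and not to exceed either gap.
    This can fail only for n = 2k with j > k, since w n is then 3 * 2^k.\<close>
  consider (dvd) "t dvd w n" "t dvd w (Suc n)" "t \<le> w (Suc n) - w n" "t \<le> 2 * w n - w (Suc n)"
    | (axis) k where "n = 2 * k" "k < j"
  proof (cases n rule: nat_parity_cases)
    case (1 k)
    show ?thesis
    proof (cases "k < j")
      case False
      then have "t dvd 2 ^ k" "t \<le> 2 ^ k" by (auto simp: t_def le_imp_power_dvd)
      then show ?thesis using 1 that(1) t(1) by (simp add: w_even_index w_odd_index)
    qed (use 1 that in blast)
  next
    case (2 k)
    \<comment> \<open>Otherwise t \<ge> w n exceeds |X| and |Y|, and divisibility by t would force X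
      = Y = 0.\<close>
    have "j \<le> Suc k"
    proof (rule ccontr)
      assume "\<not> j \<le> Suc k"
      then have "(2::int) ^ Suc (Suc k) \<le> t" unfolding t_def by (intro power_increasing) auto
      then have "w n \<le> t" by (simp add: 2 w_odd_index)
      then have "\<bar>X\<bar> < t" "\<bar>Y\<bar> < t" using XY ab' by auto
      then have "X = 0" "Y = 0" using t by (metis dvd_imp_le_int linorder_not_le abs_of_pos)+
      then show False using cd by auto
    qed
    define r :: int where "r = 2 ^ Suc k"
    have "t dvd r" "t \<le> r"
      using \<open>j \<le> Suc k\<close> unfolding t_def r_def by (rule le_imp_power_dvd, intro power_increasing) simp_all
    moreover have "w n = 2 * r" "w (Suc n) = 3 * r"
      by (simp_all add: r_def 2 w_odd_index w_even_index w_Suc_Suc)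
    ultimately show ?thesis using that(1) by simp
  qed
  then show ?thesis
  proof cases
    case dvd
    have coordinate: "represented (octagon_set n) (Gauss a b) (Gauss x y)"
      if "2 * \<bar>x\<bar> \<le> a + b" "2 * \<bar>y\<bar> \<le> a + b" "\<bar>x\<bar> + \<bar>y\<bar> \<le> a" "even (x + y)"
        "t dvd x" "t dvd y" "w n - 2 * t < x" "\<bar>y\<bar> \<le> x" for x y
      using odd_shift_coordinate[OF ab(1,2,3) ab' that(1-6) dvd(1,2) V t(1) dvd(3,4) that(7,8)]
    proof (elim disjE)
      assume *: "\<bar>x - a\<bar> \<le> w n - 2 \<and> \<bar>y - b\<bar> \<le> w n - 2 \<and> \<bar>x - a\<bar> + \<bar>y - b\<bar> \<le> w (Suc n) - 3"
      show ?thesis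
        by (rule represented_if_octagon[OF _ *]) (use that(4) ab(3) in \<open>auto simp: Gauss_dvd_associates\<close>)
    next
      assume *: "\<bar>x - b\<bar> \<le> w n - 2 \<and> \<bar>y + a\<bar> \<le> w n - 2 \<and> \<bar>x - b\<bar> + \<bar>y + a\<bar> \<le> w (Suc n) - 3"
      show ?thesis
        by (rule represented_if_octagon[OF _ *]) (use that(4) ab(3) in \<open>auto simp: Gauss_dvd_associates\<close>)
    qed
    have diagonal: "represented (octagon_set n) (Gauss a b) (Gauss x y)"
      if "2 * \<bar>x\<bar> \<le> a + b" "2 * \<bar>y\<bar> \<le> a + b" "\<bar>x\<bar> + \<bar>y\<bar> \<le> a" "even (x + y)"
        "t dvd x" "t dvd y" "0 \<le> x" "0 \<le> y" "x \<le> w n - 2 * t" "y \<le> w n - 2 * t"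
        "w (Suc n) - 3 * t < x + y" for x y
      using odd_shift_diagonal[OF ab(1,2,3) ab' that(1-6) dvd(1,2) V t(1) dvd(3,4) that(7-11)]
    proof (elim disjE)
      assume *: "\<bar>x - a\<bar> \<le> w n - 2 \<and> \<bar>y - b\<bar> \<le> w n - 2 \<and> \<bar>x - a\<bar> + \<bar>y - b\<bar> \<le> w (Suc n) - 3"
      show ?thesis
        by (rule represented_if_octagon[OF _ *]) (use that(4) ab(3) in \<open>auto simp: Gauss_dvd_associates\<close>)
    next
      assume *: "\<bar>x + b\<bar> \<le> w n - 2 \<and> \<bar>y - a\<bar> \<le> w n - 2 \<and> \<bar>x + b\<bar> + \<bar>y - a\<bar> \<le> w (Suc n) - 3"
      show ?thesis
        by (rule represented_if_octagon[OF _ *]) (use that(4) ab(3) in \<open>auto simp: Gauss_dvd_associates\<close>)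
    qed
    have quarter: "represented (octagon_set n) (Gauss a b) (Gauss x y)"
      if xy: "2 * \<bar>x\<bar> \<le> a + b" "2 * \<bar>y\<bar> \<le> a + b" "\<bar>x\<bar> + \<bar>y\<bar> \<le> a" "even (x + y)"
        "t dvd x" "t dvd y" "\<not> octagon n t x y" "0 \<le> x" "0 \<le> y" for x y
    proof -
      consider "w n - 2 * t < x" "y \<le> x" | "w n - 2 * t < y" "x \<le> y"
        | "x \<le> w n - 2 * t" "y \<le> w n - 2 * t" "w (Suc n) - 3 * t < x + y"
        using xy(7-9) unfolding octagon_def by linarith
      then show ?thesis
      proof cases
        case 1
        then show ?thesis using xy by (intro coordinate) auto
      next
        case 2
        \<comment> \<open>The rotation puts the large coordinate first; the other one becomes
          nonpositive, which \<open>coordinate\<close> permits.\<close>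
        then have "represented (octagon_set n) (Gauss a b) (Gauss y (- x))"
          using xy by (intro coordinate) auto
        then show ?thesis by (rule represented_rotate_back)
      next
        case 3
        then show ?thesis using xy by (intro diagonal) auto
      qed
    qed
    have oct_rot: "octagon n t (- Y) X \<longleftrightarrow> octagon n t X Y" "octagon n t (- X) (- Y) \<longleftrightarrow> octagon n t X Y"
      "octagon n t Y (- X) \<longleftrightarrow> octagon n t X Y"
      by (auto simp: octagon_def add.commute)
    consider "0 \<le> X" "0 \<le> Y" | "0 \<le> - Y" "0 \<le> X" | "0 \<le> - X" "0 \<le> - Y" | "0 \<le> Y" "0 \<le> - X"
      by linarith
    then show ?thesis
    proof cases
      case 1
      then show ?thesis using XY t even viol by (intro quarter) auto
    next
      case 2
      then have "represented (octagon_set n) (Gauss a b) (Gauss (- Y) X)"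
        using XY t even viol oct_rot by (intro quarter) auto
      then show ?thesis by (rule represented_rotate)
    next
      case 3
      then have "represented (octagon_set n) (Gauss a b) (Gauss (- X) (- Y))"
        using XY t even viol oct_rot by (intro quarter) auto
      then show ?thesis by (rule represented_negate)
    next
      case 4
      then have "represented (octagon_set n) (Gauss a b) (Gauss Y (- X))"
        using XY t even viol oct_rot by (intro quarter) auto
      then show ?thesis by (rule represented_rotate_back)
    qed
  next
    \<comment> \<open>Here \<open>2\<^sup>j\<close> does not divide \<open>w n\<close>; only the points \<open>2\<^sup>j u\<close> with \<open>u\<close> a unit are left.\<close>
    case (axis k)
    define s :: int where "s = 2 ^ k"
    have s: "1 \<le> s" "w n = 3 * s" "w (Suc n) = 4 * s"
      by (simp_all add: s_def axis w_even_index w_odd_index)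
    have "(2::int) ^ Suc k dvd t" unfolding t_def using axis by (intro le_imp_power_dvd) simp
    then have "2 * s dvd X" "2 * s dvd Y" using t by (auto simp: s_def intro: dvd_trans)
    then obtain e f where ef: "X = 2 * s * e" "Y = 2 * s * f" by (auto elim!: dvdE)
    have "2 * s * (\<bar>e\<bar> + \<bar>f\<bar>) < 2 * s * 2"
      using XY(3) ab' s by (simp add: ef abs_mult algebra_simps)
    then have small: "\<bar>e\<bar> + \<bar>f\<bar> < 2" using s by simp
    \<comment> \<open>Subtracting \<beta> itself works here, and the remaining three points are
      rotations of this one.\<close>
    have axis_point: "represented (octagon_set n) (Gauss a b) (Gauss (2 * s) 0)"
    proof (rule represented_if_octagon[of "2 * s - a" "0 - b"])
      show "\<bar>2 * s - a\<bar> \<le> w n - 2 \<and> \<bar>0 - b\<bar> \<le> w n - 2 \<and> \<bar>2 * s - a\<bar> + \<bar>0 - b\<bar> \<le> w (Suc n) - 3"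
        using ab(1,2) ab' s by auto
    qed (use ab(3) in \<open>auto simp: Gauss_dvd_associates\<close>)
    have p3: "represented (octagon_set n) (Gauss a b) (Gauss 0 (- (2 * s)))"
      by (rule represented_rotate) (use axis_point in simp)
    have p2: "represented (octagon_set n) (Gauss a b) (Gauss (- (2 * s)) 0)"
      by (rule represented_rotate) (use p3 in simp)
    have p1: "represented (octagon_set n) (Gauss a b) (Gauss 0 (2 * s))"
      by (rule represented_rotate) (use p2 in simp)
    have "\<not> (e = 0 \<and> f = 0)" using cd ef by auto
    then consider "e = 1" "f = 0" | "e = - 1" "f = 0" | "e = 0" "f = 1" | "e = 0" "f = - 1"
      using small by linarith
    then show ?thesis by cases (use ef axis_point p1 p2 p3 in simp_all)
  qed
qed

section \<open>Symmetry reduction and the sufficiency theorem\<close>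

lemma surjects_mod_octagon_set_symmetries:
  "surjects_mod (octagon_set n) (Gauss (- b) a) \<Longrightarrow> surjects_mod (octagon_set n) (Gauss a b)"
  "surjects_mod (octagon_set n) (Gauss a (- b)) \<Longrightarrow> surjects_mod (octagon_set n) (Gauss a b)"
proof -
  assume "surjects_mod (octagon_set n) (Gauss (- b) a)"
  then show "surjects_mod (octagon_set n) (Gauss a b)"
    unfolding surjects_mod_def by (meson Gauss_dvd_associates(3) dvd_trans)
next
  assume A: "surjects_mod (octagon_set n) (Gauss a (- b))"
  show "surjects_mod (octagon_set n) (Gauss a b)"
    unfolding surjects_mod_def
  proof
    fix z
    obtain x y where z: "z = Gauss x y" by (cases z)
    obtain p q where m: "Gauss p q \<in> octagon_set n" "Gauss a (- b) dvd Gauss x (- y) - Gauss p q"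
      using A unfolding surjects_mod_def by (metis gauss_int.exhaust)
    obtain r s where "Gauss x (- y) - Gauss p q = Gauss a (- b) * Gauss r s"
      using m(2) by (metis dvdE gauss_int.exhaust)
    then have "z - Gauss p (- q) = Gauss a b * Gauss r (- s)"
      by (simp add: z algebra_simps)
    then have "Gauss a b dvd z - Gauss p (- q)" by (rule dvdI)
    moreover have "Gauss p (- q) \<in> octagon_set n" using m(1) octagon_set_symmetries(2) by blast
    ultimately show "\<exists>m\<in>octagon_set n. Gauss a b dvd z - m" by blast
  qed
qed

text \<open>The case 0 \<le> b < a is spread by conjugation to the sector |b| < a, by a quarter turn
  to two sectors, and by a half turn to all four. Odd a + b excludes the sector boundaries |a| =
  |b|.\<close>

lemma surjects_mod_octagon_set_odd:
  assumes "Gauss a b \<in> octagon_set (Suc n)" "odd (a + b)"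
  shows "surjects_mod (octagon_set n) (Gauss a b)"
proof -
  have base: "surjects_mod (octagon_set n) (Gauss a b)"
    if ab: "Gauss a b \<in> octagon_set (Suc n)" "odd (a + b)" "0 \<le> b" "b < a" for a b
    unfolding surjects_mod_def
  proof
    fix z
    obtain X Y where XY: "Gauss a b dvd z - Gauss X Y"
      "2 * \<bar>X\<bar> \<le> a + b" "2 * \<bar>Y\<bar> \<le> a + b" "\<bar>X\<bar> + \<bar>Y\<bar> \<le> a"
      using reduction_to_square[OF ab(3,4)] by blast
    have "octagon (Suc n) 1 a b" using ab(1,2) by (subst (asm) primitive_in_octagon_set) auto
    then have "represented (octagon_set n) (Gauss a b) z"
      using represented_shift[OF represented_square_point[OF ab(3,4,2) _ XY(2-4)] XY(1)] by blast
    then show "\<exists>m\<in>octagon_set n. Gauss a b dvd z - m" by (simp add: represented_def)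
  qed
  have right: "surjects_mod (octagon_set n) (Gauss a b)"
    if "Gauss a b \<in> octagon_set (Suc n)" "odd (a + b)" "\<bar>b\<bar> < a" for a b
  proof (cases "0 \<le> b")
    case False
    then have "surjects_mod (octagon_set n) (Gauss a (- b))"
      using that octagon_set_symmetries(2)[of a b] by (intro base) auto
    then show ?thesis by (rule surjects_mod_octagon_set_symmetries(2))
  qed (use that in \<open>auto intro: base\<close>)
  have upper: "surjects_mod (octagon_set n) (Gauss a b)"
    if "Gauss a b \<in> octagon_set (Suc n)" "odd (a + b)" "\<bar>b\<bar> < a \<or> \<bar>a\<bar> < - b" for a b
  proof (cases "\<bar>b\<bar> < a")
    case False
    then have "\<bar>a\<bar> < - b" using that(3) by blast
    then have "surjects_mod (octagon_set n) (Gauss (- b) a)"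
      using that octagon_set_symmetries(1)[of a b] by (intro right) auto
    then show ?thesis by (rule surjects_mod_octagon_set_symmetries(1))
  qed (use that in \<open>auto intro: right\<close>)
  have "\<bar>a\<bar> \<noteq> \<bar>b\<bar>" using assms(2) by (metis dvd_abs_iff even_add)
  then consider "\<bar>b\<bar> < a \<or> \<bar>a\<bar> < - b" | "\<bar>b\<bar> < - a \<or> \<bar>a\<bar> < b" by linarith
  then show ?thesis
  proof cases
    case 2
    then have "surjects_mod (octagon_set n) (Gauss (- a) (- b))"
      using assms octagon_set_symmetries(1)[of a b "Suc n"] octagon_set_symmetries(1)[of "- b" a "Suc n"]
      by (intro upper) auto
    then have "surjects_mod (octagon_set n) (Gauss (- b) a)"
      by (intro surjects_mod_octagon_set_symmetries(1)[where a = "- b"])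
    then show ?thesis by (rule surjects_mod_octagon_set_symmetries(1))
  qed (use assms upper in blast)
qed

text \<open>Removing a factor 1+i lowers the level by one, hence the induction on n; odd \<beta> are
  settled directly.\<close>

lemma octagon_set_imp_surjects_mod:
  assumes "\<beta> \<in> octagon_set (Suc n)" "\<beta> \<noteq> 0"
  shows "surjects_mod (octagon_set n) \<beta>"
  using assms
proof (induction n arbitrary: \<beta> rule: less_induct)
  case (less n)
  show ?case
  proof (cases "even (gre \<beta> + gim \<beta>)")
    case True
    then obtain y where y: "\<beta> = Gauss 1 1 * y" by (rule even_sum_factor_1_i)
    then have "y \<in> octagon_set n" "y \<noteq> 0"
      using less.prems octagon_set_mult_1_i_cancel by auto
    then show ?thesis unfolding y
      by (intro surjects_mod_octagon_set_1_i_mult) (auto intro: less.IH)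
  next
    case False
    then show ?thesis using surjects_mod_octagon_set_odd[of "gre \<beta>" "gim \<beta>" n] less.prems by simp
  qed
qed

section \<open>Identification with the Motzkin sets\<close>

lemma motzkin_eq_octagon_set: "motzkin n = octagon_set n"
proof (induction n)
  case 0
  show ?case by (simp add: octagon_set_0)
next
  case (Suc n)
  show ?case
  proof (intro equalityI subsetI)
    fix z assume "z \<in> motzkin (Suc n)"
    then show "z \<in> octagon_set (Suc n)"
      using Suc octagon_set_subset_Suc surjects_mod_octagon_set_imp by auto
  next
    fix z assume "z \<in> octagon_set (Suc n)"
    then show "z \<in> motzkin (Suc n)"
      using Suc octagon_set_imp_surjects_mod[of z n] by (cases "z = 0") auto
  qed
qed

lemma mono_motzkin: "m \<le> n \<Longrightarrow> motzkin m \<subseteq> motzkin n"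
  by (rule lift_Suc_mono_le[of motzkin]) simp_all

text \<open>Without this the \<open>LEAST\<close> in \<open>min_euclid\<close> need not be
  attained.\<close>

lemma ex_motzkin: "\<exists>n. z \<in> motzkin n"
proof (cases "z = 0")
  case False
  obtain j c d where cd: "gre z = 2 ^ j * c" "gim z = 2 ^ j * d" "\<not> (even c \<and> even d)"
    using pow2_primitive_part[of "gre z" "gim z"] False by auto
  then have z: "z = Gauss (2 ^ j * c) (2 ^ j * d)" by (simp add: gauss_int_eq_iff)
  \<comment> \<open>From N < 2^N the octagon of index 2N contains c + di; the factor 2^j then costs
    2j further levels.\<close>
  define N where "N = nat (\<bar>c\<bar> + \<bar>d\<bar>)"
  have "int N < int (2 ^ N)" using less_exp[of N] by (simp only: of_nat_less_iff)
  then have "int N < 2 ^ N" "(1::int) \<le> 2 ^ N" by simp_all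
  moreover have "int N = \<bar>c\<bar> + \<bar>d\<bar>" by (simp add: N_def)
  ultimately have "octagon (2 * N) 1 c d"
    unfolding octagon_def w_even_index w_odd_index by linarith
  then have "z \<in> octagon_set (2 * N + 2 * j)"
    unfolding z using cd(3) by (simp add: scaled_in_octagon_set)
  then show ?thesis using motzkin_eq_octagon_set by blast
qed (auto simp: motzkin_eq_octagon_set)

lemma min_euclid_fibre_Suc: "min_euclid_fibre (Suc n) = octagon_set (Suc n) - octagon_set n"
proof -
  have "min_euclid z = Suc n \<longleftrightarrow> z \<in> motzkin (Suc n) \<and> z \<notin> motzkin n" for z
  proof
    assume *: "min_euclid z = Suc n"
    have "z \<in> motzkin (min_euclid z)" unfolding min_euclid_def by (rule LeastI_ex[OF ex_motzkin])
    moreover have "z \<notin> motzkin n" using * not_less_Least[of n "\<lambda>j. z \<in> motzkin j"] by (simp add: min_euclid_def)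
    ultimately show "z \<in> motzkin (Suc n) \<and> z \<notin> motzkin n" using * by simp
  next
    assume *: "z \<in> motzkin (Suc n) \<and> z \<notin> motzkin n"
    show "min_euclid z = Suc n" unfolding min_euclid_def
    proof (rule Least_equality)
      fix j assume "z \<in> motzkin j"
      then show "Suc n \<le> j" using * mono_motzkin[of j n] by (meson not_less_eq_eq subsetD)
    qed (use * in blast)
  qed
  then show ?thesis
    unfolding min_euclid_fibre_def by (auto simp: motzkin_eq_octagon_set)
qed

section \<open>Decomposition of the fibres into layers\<close>

text \<open>A common form for both parities: index 2k gives \<open>odd_layer k\<close>, and index
  2k+1 gives \<open>even_layer (k+1)\<close>. The final disjunction in those definitions is the
  failure of the smaller octagon.\<close>

definition layer :: "nat \<Rightarrow> nat \<Rightarrow> gauss_int set" where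
  "layer n j = {Gauss a b | a b. pow2_exactly_divides j (Gauss a b) \<and>
     octagon (Suc n) (2 ^ j) a b \<and> \<not> octagon n (2 ^ j) a b}"

lemma octagon_diff_iff:
  "octagon (Suc n) t a b \<and> \<not> octagon n t a b \<longleftrightarrow>
     \<bar>a\<bar> \<le> w (Suc n) - 2 * t \<and> \<bar>b\<bar> \<le> w (Suc n) - 2 * t \<and> \<bar>a\<bar> + \<bar>b\<bar> \<le> w (Suc (Suc n)) - 3 * t \<and>
     (max \<bar>a\<bar> \<bar>b\<bar> > w n - 2 * t \<or> \<bar>a\<bar> + \<bar>b\<bar> > w (Suc n) - 3 * t)"
  unfolding octagon_def by (auto simp: less_max_iff_disj)

lemma odd_layer_eq_layer: "odd_layer k j = layer (2 * k) j"
  by (simp add: odd_layer_def layer_def octagon_diff_iff w_Suc_Suc)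

lemma even_layer_eq_layer: "even_layer (Suc k) j = layer (Suc (2 * k)) j"
  by (simp add: even_layer_def layer_def octagon_diff_iff w_Suc_Suc)

lemma layer_disjoint: "i \<noteq> j \<Longrightarrow> layer n i \<inter> layer n j = {}"
  using pow2_exactly_divides_unique by (auto simp: layer_def)

lemma layer_scaled_cases:
  assumes "z \<in> layer n j"
  obtains c d where "z = Gauss (2 ^ j * c) (2 ^ j * d)" "\<not> (even c \<and> even d)" "2 * j \<le> Suc n"
    "octagon (Suc n - 2 * j) 1 c d"
proof -
  obtain a b where ab: "z = Gauss a b" "pow2_exactly_divides j (Gauss a b)" "octagon (Suc n) (2 ^ j) a b"
    using assms by (auto simp: layer_def)
  then have "2 ^ j dvd a" "2 ^ j dvd b" by (auto simp: pow2_exactly_divides_Gauss)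
  then obtain c d where cd: "a = 2 ^ j * c" "b = 2 ^ j * d" by (auto elim!: dvdE)
  have odd: "\<not> (even c \<and> even d)" using ab cd by (simp add: pow2_exactly_divides_scaled)
  have "z \<in> octagon_set (Suc n)" using ab by (simp add: Gauss_in_octagon_set)
  then show ?thesis using that[OF _ odd] ab(1) cd scaled_in_octagon_set[OF odd] by simp
qed

lemma octagon_set_diff:
  "octagon_set (Suc n) - octagon_set n = (\<Union>j\<in>{0..Suc n div 2}. layer n j)"
proof (intro equalityI subsetI)
  fix z assume z: "z \<in> octagon_set (Suc n) - octagon_set n"
  then have "z \<noteq> 0" by auto
  then obtain a b j where j: "z = Gauss a b" "pow2_exactly_divides j (Gauss a b)" "octagon (Suc n) (2 ^ j) a b"
    using z by (auto simp: octagon_set_def)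
  then have l: "z \<in> layer n j" using z by (auto simp: layer_def Gauss_in_octagon_set)
  then have "2 * j \<le> Suc n" by (rule layer_scaled_cases)
  with l show "z \<in> (\<Union>j\<in>{0..Suc n div 2}. layer n j)" by auto
next
  fix z assume "z \<in> (\<Union>j\<in>{0..Suc n div 2}. layer n j)"
  then show "z \<in> octagon_set (Suc n) - octagon_set n"
    by (auto simp: layer_def Gauss_in_octagon_set)
qed

text \<open>For this exponent the primitive part lies in the octagon of index 0, so it is a unit.
  All four units occur, because the exponent is too large for the preceding level.\<close>

lemma top_even_layer:
  "layer (Suc (2 * k)) (Suc k) =
     {2 ^ Suc k, - (2 ^ Suc k), 2 ^ Suc k * imag_unit, - (2 ^ Suc k * imag_unit)}"
proof -
  have "z \<in> layer (Suc (2 * k)) (Suc k) \<longleftrightarrow>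
      (\<exists>c d. \<bar>c\<bar> + \<bar>d\<bar> = 1 \<and> z = Gauss (2 ^ Suc k * c) (2 ^ Suc k * d))" for z
  proof
    assume "z \<in> layer (Suc (2 * k)) (Suc k)"
    then show "\<exists>c d. \<bar>c\<bar> + \<bar>d\<bar> = 1 \<and> z = Gauss (2 ^ Suc k * c) (2 ^ Suc k * d)"
    proof (rule layer_scaled_cases)
      fix c d assume z: "z = Gauss (2 ^ Suc k * c) (2 ^ Suc k * d)" and o: "\<not> (even c \<and> even d)"
        "octagon (Suc (Suc (2 * k)) - 2 * Suc k) 1 c d"
      then have "\<bar>c\<bar> + \<bar>d\<bar> \<le> 1" by (simp add: octagon_def w_def)
      moreover have "\<not> (c = 0 \<and> d = 0)" using o(1) by auto
      ultimately have "\<bar>c\<bar> + \<bar>d\<bar> = 1" by linarith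
      with z show ?thesis by blast
    qed
  next
    assume "\<exists>c d. \<bar>c\<bar> + \<bar>d\<bar> = 1 \<and> z = Gauss (2 ^ Suc k * c) (2 ^ Suc k * d)"
    then obtain c d where cd: "\<bar>c\<bar> + \<bar>d\<bar> = 1" "z = Gauss (2 ^ Suc k * c) (2 ^ Suc k * d)" by blast
    have odd: "\<not> (even c \<and> even d)" using cd(1) by (auto elim!: evenE) presburger
    have p: "pow2_exactly_divides (Suc k) z"
      unfolding cd(2) pow2_exactly_divides_scaled by (rule odd)
    have "octagon 0 1 c d" using cd(1) by (auto simp: octagon_def w_def)
    then have "z \<in> octagon_set (Suc (Suc (2 * k)))" "z \<notin> octagon_set (Suc (2 * k))"
      unfolding cd(2) scaled_in_octagon_set[OF odd] by simp_all
    then show "z \<in> layer (Suc (2 * k)) (Suc k)"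
      using p unfolding cd(2) layer_def by (auto simp: Gauss_in_octagon_set simp del: power_Suc)
  qed
  moreover have "(\<exists>c d :: int. \<bar>c\<bar> + \<bar>d\<bar> = 1 \<and> P c d) \<longleftrightarrow> P 1 0 \<or> P (- 1) 0 \<or> P 0 1 \<or> P 0 (- 1)" for P
  proof -
    have "\<bar>c\<bar> + \<bar>d\<bar> = 1 \<longleftrightarrow>
        c = 1 \<and> d = 0 \<or> c = - 1 \<and> d = 0 \<or> c = 0 \<and> d = 1 \<or> c = 0 \<and> d = - 1" for c d :: int
      by auto
    then show ?thesis by auto
  qed
  ultimately show ?thesis
    by (auto simp: two_power_gauss imag_unit_def simp del: power_Suc)
qed

theorem theorem1p3:
  fixes k :: nat
  assumes "k \<ge> 1"
  shows "min_euclid_fibre (2 * k + 1) = (\<Union>j\<in>{0..k}. odd_layer k j)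
       \<and> (\<forall>i\<in>{0..k}. \<forall>j\<in>{0..k}. i \<noteq> j \<longrightarrow> odd_layer k i \<inter> odd_layer k j = {})
       \<and> min_euclid_fibre (2 * k) =
           {2 ^ k, - (2 ^ k), 2 ^ k * imag_unit, - (2 ^ k * imag_unit)}
           \<union> (\<Union>j\<in>{0..k - 1}. even_layer k j)
       \<and> (\<forall>i\<in>{0..k - 1}. \<forall>j\<in>{0..k - 1}. i \<noteq> j \<longrightarrow> even_layer k i \<inter> even_layer k j = {})"
proof -
  obtain l where k: "k = Suc l" using assms by (cases k) auto
  have "min_euclid_fibre (2 * k + 1) = (\<Union>j\<in>{0..k}. odd_layer k j)"
    by (simp add: min_euclid_fibre_Suc octagon_set_diff odd_layer_eq_layer)
  moreover have "min_euclid_fibre (2 * k) =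
      {2 ^ k, - (2 ^ k), 2 ^ k * imag_unit, - (2 ^ k * imag_unit)} \<union> (\<Union>j\<in>{0..k - 1}. even_layer k j)"
  proof -
    have "min_euclid_fibre (2 * k) = (\<Union>j\<in>{0..Suc l}. layer (Suc (2 * l)) j)"
      by (simp add: k min_euclid_fibre_Suc octagon_set_diff)
    \<comment> \<open>The top exponent is split off, as its layer is the explicit four-element
      set.\<close>
    also have "{0..Suc l} = insert (Suc l) {0..l}" by auto
    finally show ?thesis
      unfolding k even_layer_eq_layer using top_even_layer[of l] by simp
  qed
  ultimately show ?thesis
    using layer_disjoint by (simp add: odd_layer_eq_layer even_layer_eq_layer k)
qed

end
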